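(* Let $n\ge 0$, let $P_{n+1}$ be the path with vertices $v_0,\dots,v_n$ and edges $v_iv_{i+1}$, let $w:\{v_0,\dots,v_n\}\to\mathbb{N}$ be a weight function, and let $L^c$ be a waterfall list of $P_{n+1}$. Then $P_{n+1}$ is $(L^c,w)$-colorable if and only if for all $i,j\in\{0,\dots,n\}$ with $i\le j$, $$\Big|\bigcup_{k=i}^{j}L^c(k)\Big|\ \ge\ \sum_{k=i}^{j}w(k).$$
   Context: A list $L$ assigns to each vertex a finite subset of $\mathbb{N}$; write $L(i)=L(v_i)$, $w(i)=w(v_i)$. An $(L,w)$-coloring is a map $c$ with $c(v)\subseteq L(v)$, $|c(v)|=w(v)$ for each vertex $v$, and $c(v)\cap c(v')=\emptyset$ for each edge $vv'$; the graph is $(L,w)$-colorable if one exists. A list $L$ of $P_{n+1}$ is a waterfall list if $L(i)\cap L(j)=\emptyset$ whenever $|i-j|\ge 2$. *)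

theory Defs
  imports "Graph_Theory.Pair_Digraph"
begin

text \<open>Undirected graphs are represented, as in the library, by symmetric sets of arcs. Lists,
  weights and colorings are total functions; only their values on the vertices are constrained.\<close>

definition list_of :: "'a pair_pre_digraph \<Rightarrow> ('a \<Rightarrow> nat set) \<Rightarrow> bool" where
  "list_of G L \<longleftrightarrow> (\<forall>v\<in>pverts G. finite (L v))"

definition is_coloring ::
  "'a pair_pre_digraph \<Rightarrow> ('a \<Rightarrow> nat set) \<Rightarrow> ('a \<Rightarrow> nat) \<Rightarrow> ('a \<Rightarrow> nat set) \<Rightarrow> bool" where
  "is_coloring G L w c \<longleftrightarrow>
     (\<forall>v\<in>pverts G. c v \<subseteq> L v \<and> card (c v) = w v) \<and>
     (\<forall>(v, v')\<in>parcs G. c v \<inter> c v' = {})"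

definition colorable ::
  "'a pair_pre_digraph \<Rightarrow> ('a \<Rightarrow> nat set) \<Rightarrow> ('a \<Rightarrow> nat) \<Rightarrow> bool" where
  "colorable G L w \<longleftrightarrow> (\<exists>c. is_coloring G L w c)"

text \<open>\<open>path_graph n\<close> has the \<open>n + 1\<close> vertices \<open>0, \<dots>, n\<close>, the number \<open>i\<close> standing
  for \<open>v\<^sub>i\<close>.\<close>

definition path_graph :: "nat \<Rightarrow> nat pair_pre_digraph" where
  "path_graph n =
     \<lparr> pverts = {0..n}, parcs = (\<Union>i<n. {(i, Suc i), (Suc i, i)}) \<rparr>"

lemma pair_graph_path_graph: "pair_graph (path_graph n)"
proof
  show "symmetric (with_proj (path_graph n))"
    by (auto simp: path_graph_def symmetric_def sym_def arcs_ends_conv)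
qed (auto simp: path_graph_def)

definition waterfall_list :: "nat \<Rightarrow> (nat \<Rightarrow> nat set) \<Rightarrow> bool" where
  "waterfall_list n L \<longleftrightarrow> list_of (path_graph n) L \<and>
     (\<forall>i\<in>pverts (path_graph n). \<forall>j\<in>pverts (path_graph n).
        \<bar>int i - int j\<bar> \<ge> 2 \<longrightarrow> L i \<inter> L j = {})"

end

theory Submission
  imports Defs
begin

text \<open>The color classes of a path with a waterfall list are pairwise disjoint, which gives
  necessity. For sufficiency, color the last vertex first, preferring the colors that its neighbor
  does not have, and delete the chosen colors from the other lists. Either no other list changes,
  or every color private to the last vertex has been used, so that each union ending at the
  neighbor is the union ending at the last vertex minus exactly the chosen colors. In both cases
  the cardinality condition survives on the shorter path.\<close>

lemma waterfall_list_iff: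
  "waterfall_list n L \<longleftrightarrow>
    (\<forall>i\<le>n. finite (L i)) \<and> (\<forall>i j. Suc i < j \<longrightarrow> j \<le> n \<longrightarrow> L i \<inter> L j = {})"
proof
  assume "waterfall_list n L"
  then show "(\<forall>i\<le>n. finite (L i)) \<and> (\<forall>i j. Suc i < j \<longrightarrow> j \<le> n \<longrightarrow> L i \<inter> L j = {})"
    by (auto simp: waterfall_list_def list_of_def path_graph_def Ball_def)
next
  assume R: "(\<forall>i\<le>n. finite (L i)) \<and> (\<forall>i j. Suc i < j \<longrightarrow> j \<le> n \<longrightarrow> L i \<inter> L j = {})"
  have "L i \<inter> L j = {}" if "i \<le> n" "j \<le> n" "\<bar>int i - int j\<bar> \<ge> 2" for i j
  proof -
    from that(3) consider "Suc i < j" | "Suc j < i"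
      by linarith
    then show ?thesis
      using R that by cases blast+
  qed
  with R show "waterfall_list n L"
    by (simp add: waterfall_list_def list_of_def path_graph_def)
qed

lemma is_coloring_path_graph_iff:
  "is_coloring (path_graph n) L w c \<longleftrightarrow>
    (\<forall>i\<le>n. c i \<subseteq> L i \<and> card (c i) = w i) \<and> (\<forall>i<n. c i \<inter> c (Suc i) = {})"
  by (auto simp: is_coloring_def path_graph_def)

text \<open>Classes at adjacent vertices are disjoint by the coloring, those at vertices further
  apart because the lists containing them are. So the sizes of the classes add up inside the union
  of the lists.\<close>

lemma sum_weights_le_card_Union:
  assumes W: "waterfall_list n L" and C: "is_coloring (path_graph n) L w c" and "j \<le> n"
  shows "(\<Sum>k=i..j. w k) \<le> card (\<Union>k\<in>{i..j}. L k)"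
proof -
  have sub: "c k \<subseteq> L k" "card (c k) = w k" "finite (L k)" if "k \<le> n" for k
    using W C that by (auto simp: waterfall_list_iff is_coloring_path_graph_iff)
  have less: "c a \<inter> c b = {}" if "a < b" "b \<le> n" for a b
  proof (cases "b = Suc a")
    case True
    then show ?thesis
      using C that by (simp add: is_coloring_path_graph_iff)
  next
    case False
    then have "L a \<inter> L b = {}"
      using W that by (simp add: waterfall_list_iff)
    then show ?thesis
      using sub(1)[of a] sub(1)[of b] that by auto
  qed
  have "c a \<inter> c b = {}" if "a \<le> n" "b \<le> n" "a \<noteq> b" for a b
    using less[of a b] less[of b a] that by (cases "a < b") auto
  then have "card (\<Union>k\<in>{i..j}. c k) = (\<Sum>k=i..j. card (c k))"
    using \<open>j \<le> n\<close> by (intro card_UN_disjoint) (auto intro: finite_subset[OF sub(1) sub(3)])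
  also have "\<dots> = (\<Sum>k=i..j. w k)"
    using sub(2) \<open>j \<le> n\<close> by (intro sum.cong) auto
  finally have "(\<Sum>k=i..j. w k) = card (\<Union>k\<in>{i..j}. c k)" ..
  also have "\<dots> \<le> card (\<Union>k\<in>{i..j}. L k)"
    using sub \<open>j \<le> n\<close> by (intro card_mono UN_mono) auto
  finally show ?thesis .
qed

text \<open>Serves the choice at the last vertex, with \<open>A\<close> its list and
  \<open>B\<close> that of its neighbor. If \<open>A - B\<close> has at least \<open>m\<close>
  elements, \<open>C\<close> fits inside it; otherwise \<open>C\<close> is grown from all of
  \<open>A - B\<close>.\<close>

lemma ex_subset_card_preferring:
  assumes "finite A" "m \<le> card A"
  obtains C where "C \<subseteq> A" "card C = m" "C \<inter> B = {} \<or> A - B \<subseteq> C"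
proof (cases "m \<le> card (A - B)")
  case True
  then obtain C where "C \<subseteq> A - B" "card C = m"
    by (meson obtain_subset_with_card_n)
  then show ?thesis
    by (intro that) auto
next
  case False
  then obtain C where "A - B \<subseteq> C" "C \<subseteq> A" "card C = m"
    using assms exists_subset_between[of "A - B" m A] by auto
  then show ?thesis
    by (intro that) auto
qed

text \<open>Induction removes the last vertex. The list is generalized because the shorter path is
  colored from reduced lists, while the weights stay fixed.\<close>

lemma colorable_path_graph:
  assumes "waterfall_list n L"
    and "\<And>i j. i \<le> j \<Longrightarrow> j \<le> n \<Longrightarrow> (\<Sum>k=i..j. w k) \<le> card (\<Union>k\<in>{i..j}. L k)"
  shows "colorable (path_graph n) L w"
  using assms
proof (induction n arbitrary: L)
  case 0
  then have "w 0 \<le> card (L 0)"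
    using "0.prems"(2)[of 0 0] by simp
  then obtain C where "C \<subseteq> L 0" "card C = w 0"
    by (meson obtain_subset_with_card_n)
  then have "is_coloring (path_graph 0) L w (\<lambda>_. C)"
    by (simp add: is_coloring_path_graph_iff)
  then show ?case
    by (auto simp: colorable_def)
next
  case (Suc n)
  have fin: "finite (L i)" if "i \<le> Suc n" for i
    using Suc.prems(1) that by (simp add: waterfall_list_iff)
  have disj: "L i \<inter> L j = {}" if "Suc i < j" "j \<le> Suc n" for i j
    using Suc.prems(1) that by (simp add: waterfall_list_iff)
  have "w (Suc n) \<le> card (L (Suc n))"
    using Suc.prems(2)[of "Suc n" "Suc n"] by simp
  then obtain C where C: "C \<subseteq> L (Suc n)" "card C = w (Suc n)"
    and pref: "C \<inter> L n = {} \<or> L (Suc n) - L n \<subseteq> C"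
    using fin ex_subset_card_preferring by (metis order_refl)
  define L' where "L' k = L k - C" for k
  \<comment> \<open>Vertices \<open>k < n\<close> are at distance at least two from
    \<open>Suc n\<close>, so \<open>C\<close> misses their lists; on the shorter path only the list
    at \<open>n\<close> can shrink.\<close>
  have L'_eq: "L' k = L k" if "k < n" for k
    using disj[of k "Suc n"] that C(1) by (auto simp: L'_def)
  have "waterfall_list n L'"
    using fin disj by (fastforce simp: waterfall_list_iff L'_def)
  moreover have "(\<Sum>k=i..j. w k) \<le> card (\<Union>k\<in>{i..j}. L' k)" if ij: "i \<le> j" "j \<le> n" for i j
  \<comment> \<open>The split isolates the only intervals whose union can lose colors: those ending
    at \<open>n\<close> when \<open>C\<close> meets \<open>L n\<close>.\<close>
  proof (cases "j < n \<or> C \<inter> L n = {}")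
    case True
    then have "L' k = L k" if "k \<in> {i..j}" for k
      using that ij L'_eq[of k] by (cases "k = n") (auto simp: L'_def)
    then have "(\<Union>k\<in>{i..j}. L' k) = (\<Union>k\<in>{i..j}. L k)"
      by auto
    then show ?thesis
      using Suc.prems(2)[of i j] ij by simp
  next
    case False
    then have j: "j = n" and priv: "L (Suc n) - L n \<subseteq> C"
      using ij pref by auto
    \<comment> \<open>By \<open>priv\<close>, whatever \<open>C\<close> leaves of
      \<open>L (Suc n)\<close> lies in \<open>L n\<close>, so extending the interval to
      \<open>Suc n\<close> adds no color outside \<open>C\<close>.\<close>
    have "(\<Union>k\<in>{i..n}. L' k) = (\<Union>k\<in>{i..Suc n}. L k) - C"
      using priv ij j by (auto simp: L'_def atLeastAtMostSuc_conv)
    moreover have "C \<subseteq> (\<Union>k\<in>{i..Suc n}. L k)"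
      using C(1) ij by force
    ultimately have "card (\<Union>k\<in>{i..n}. L' k) = card (\<Union>k\<in>{i..Suc n}. L k) - w (Suc n)"
      using C fin by (simp add: card_Diff_subset finite_subset[OF C(1)])
    \<comment> \<open>The condition on the extended interval has room for \<open>w (Suc n)\<close>,
      exactly the number of deleted colors; it also makes the natural-number subtraction above
      exact.\<close>
    moreover have "(\<Sum>k=i..n. w k) + w (Suc n) \<le> card (\<Union>k\<in>{i..Suc n}. L k)"
      using Suc.prems(2)[of i "Suc n"] ij by simp
    ultimately show ?thesis
      unfolding j by linarith
  qed
  ultimately have "colorable (path_graph n) L' w"
    by (rule Suc.IH)
  then obtain c where c: "\<And>i. i \<le> n \<Longrightarrow> c i \<subseteq> L i - C \<and> card (c i) = w i"
    "\<And>i. i < n \<Longrightarrow> c i \<inter> c (Suc i) = {}"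
    by (auto simp: colorable_def is_coloring_path_graph_iff L'_def)
  \<comment> \<open>The new edge causes no conflict: \<open>c n\<close> was chosen from
    \<open>L n - C\<close>.\<close>
  have "is_coloring (path_graph (Suc n)) L w (c(Suc n := C))"
    unfolding is_coloring_path_graph_iff
  proof (intro conjI allI impI)
    fix i assume "i < Suc n"
    then show "(c(Suc n := C)) i \<inter> (c(Suc n := C)) (Suc i) = {}"
      using c(1)[of n] c(2)[of i] by (cases "i = n") auto
  qed (use c(1) C in \<open>force simp: le_Suc_eq\<close>)+
  then show ?case
    by (auto simp: colorable_def)
qed

theorem theorem2:
  fixes n :: nat and w :: "nat \<Rightarrow> nat" and L :: "nat \<Rightarrow> nat set"
  assumes "waterfall_list n L"
  shows "colorable (path_graph n) L w \<longleftrightarrow>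
    (\<forall>i\<in>{0..n}. \<forall>j\<in>{0..n}. i \<le> j \<longrightarrow>
       card (\<Union>k\<in>{i..j}. L k) \<ge> (\<Sum>k=i..j. w k))"
proof
  assume "colorable (path_graph n) L w"
  then show "\<forall>i\<in>{0..n}. \<forall>j\<in>{0..n}. i \<le> j \<longrightarrow>
      card (\<Union>k\<in>{i..j}. L k) \<ge> (\<Sum>k=i..j. w k)"
    using sum_weights_le_card_Union[OF assms] by (auto simp: colorable_def)
next
  assume "\<forall>i\<in>{0..n}. \<forall>j\<in>{0..n}. i \<le> j \<longrightarrow>
      card (\<Union>k\<in>{i..j}. L k) \<ge> (\<Sum>k=i..j. w k)"
  then show "colorable (path_graph n) L w"
    by (intro colorable_path_graph[OF assms]) auto
qed

end
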